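(* Let $K$ be an infinite field, $n\ge 2$, and $S=K[x_1,\ldots,x_n]$. Let $I\subset S$ be an ideal of Borel type and let $e\ge \mathrm{reg}(I)$ be an integer. Then $I_{\ge e}$ is stable.
   Context: $S=K[x_1,\ldots,x_n]$ has the standard grading. A monomial ideal $I\subset S$ is of Borel type if $(I:x_j^\infty)=(I:(x_1,\ldots,x_j)^\infty)$ for all $j=1,\ldots,n$, where $(I:J^\infty)=\bigcup_{k\ge 1}(I:J^k)$. For a monomial $u\ne 1$, $m(u)=\max\{i: x_i\mid u\}$. A monomial ideal $I$ is stable if for every monomial $u\in I$, $u\neq 1$, and every $i<m(u)$ one has $x_iu/x_{m(u)}\in I$. For a monomial ideal $I$ and an integer $e$, $I_{\ge e}$ is the ideal generated by the monomials of degree $\ge e$ in $I$. $\mathrm{reg}(I)$ is the Castelnuovo-Mumford regularity of $I$ as a graded $S$-module, $\mathrm{reg}(I)=\max\{j-i: \mathrm{Tor}_i^S(I,K)_j\ne 0\}$. *)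

theory Defs
  imports
    Complex_Main
    "HOL-Library.Poly_Mapping"
    "HOL-Library.Cardinality"
    "HOL-Library.Extended_Real"
    "Jordan_Normal_Form.Matrix"
begin

section \<open>Polynomial rings in finitely many ordered variables\<close>

text \<open>The variables are indexed by a finite linearly ordered type \<open>'v\<close>, which plays the role of
  \<open>{1, \<dots>, n}\<close> with \<open>n = CARD('v)\<close>. Elements of \<open>'v \<Rightarrow>\<^sub>0 nat\<close> are exponent vectors.\<close>

type_synonym ('v, 'k) mpoly = "('v \<Rightarrow>\<^sub>0 nat) \<Rightarrow>\<^sub>0 'k"

definition monomial :: "('v \<Rightarrow>\<^sub>0 nat) \<Rightarrow> ('v, 'k::field) mpoly" where
  "monomial t = Poly_Mapping.single t 1"

definition Var :: "'v \<Rightarrow> ('v, 'k::field) mpoly" where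
  "Var i = monomial (Poly_Mapping.single i 1)"

definition mdeg :: "('v::finite \<Rightarrow>\<^sub>0 nat) \<Rightarrow> nat" where
  "mdeg t = (\<Sum>i\<in>UNIV. Poly_Mapping.lookup t i)"

text \<open>Degrees are integers, so that graded shifts can be expressed; the only homogeneous
  polynomial of negative degree is 0, and 0 is homogeneous of every degree.\<close>

definition homogeneous :: "int \<Rightarrow> ('v::finite, 'k::field) mpoly \<Rightarrow> bool" where
  "homogeneous d f \<longleftrightarrow> (\<forall>t\<in>Poly_Mapping.keys f. int (mdeg t) = d)"


section \<open>Ideals\<close>

lemma module_mult: "Modules.module ((*) :: 'a::comm_ring_1 \<Rightarrow> 'a \<Rightarrow> 'a)"
  by unfold_locales (simp_all add: algebra_simps)

text \<open>The ideal generated by a set is its span in the ring regarded as a module over itself.\<close>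

abbreviation ideal_gen :: "'a::comm_ring_1 set \<Rightarrow> 'a set" where
  "ideal_gen \<equiv> Modules.module.span (*)"

definition ideal_times :: "'a::comm_ring_1 set \<Rightarrow> 'a set \<Rightarrow> 'a set" where
  "ideal_times I J = ideal_gen {a * b | a b. a \<in> I \<and> b \<in> J}"

primrec ideal_power :: "'a::comm_ring_1 set \<Rightarrow> nat \<Rightarrow> 'a set" where
  "ideal_power J 0 = UNIV"
| "ideal_power J (Suc k) = ideal_times J (ideal_power J k)"

definition colon :: "'a::comm_ring_1 set \<Rightarrow> 'a set \<Rightarrow> 'a set" where
  "colon I J = {f. \<forall>g\<in>J. f * g \<in> I}"

definition saturation :: "'a::comm_ring_1 set \<Rightarrow> 'a set \<Rightarrow> 'a set" where
  "saturation I J = (\<Union>k\<in>{1..}. colon I (ideal_power J k))"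


section \<open>Monomial ideals, ideals of Borel type, stable ideals\<close>

definition monomial_ideal :: "('v, 'k::field) mpoly set \<Rightarrow> bool" where
  "monomial_ideal I \<longleftrightarrow> (\<exists>T. I = ideal_gen (monomial ` T))"

definition borel_type :: "('v::{finite,linorder}, 'k::field) mpoly set \<Rightarrow> bool" where
  "borel_type I \<longleftrightarrow> monomial_ideal I \<and>
     (\<forall>j. saturation I (ideal_gen {Var j}) = saturation I (ideal_gen (Var ` {i. i \<le> j})))"

definition max_var :: "('v::{finite,linorder} \<Rightarrow>\<^sub>0 nat) \<Rightarrow> 'v" where
  "max_var t = Max (Poly_Mapping.keys t)"

text \<open>The exponent vector of \<open>x\<^sub>i u / x\<^bsub>m(u)\<^esub>\<close> is formed below with truncated subtraction, which is
  exact because the exponent of \<open>x\<^bsub>m(u)\<^esub>\<close> in \<open>u \<noteq> 1\<close> is positive.\<close>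

definition stable_ideal :: "('v::{finite,linorder}, 'k::field) mpoly set \<Rightarrow> bool" where
  "stable_ideal I \<longleftrightarrow> monomial_ideal I \<and>
     (\<forall>u i. monomial u \<in> I \<and> u \<noteq> 0 \<and> i < max_var u \<longrightarrow>
        monomial (Poly_Mapping.single i 1 + u - Poly_Mapping.single (max_var u) 1) \<in> I)"

definition ideal_ge :: "('v::finite, 'k::field) mpoly set \<Rightarrow> int \<Rightarrow> ('v, 'k) mpoly set" where
  "ideal_ge I e = ideal_gen {monomial t | t. monomial t \<in> I \<and> e \<le> int (mdeg t)}"


section \<open>Graded free resolutions, Tor and regularity\<close>

text \<open>A complex of finitely generated graded free modules
  \<open>\<dots> \<rightarrow> F\<^sub>2 \<rightarrow> F\<^sub>1 \<rightarrow> F\<^sub>0 \<rightarrow> I \<rightarrow> 0\<close> is given by the following data.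
  The list \<open>D i\<close> contains the degrees of the basis elements of \<open>F\<^sub>i\<close>, so that \<open>F\<^sub>i\<close> is the direct sum
  of the \<open>S(-D i ! k)\<close> for \<open>k < length (D i)\<close>, with underlying module \<open>carrier_vec (length (D i))\<close>.
  The matrix \<open>A i\<close> represents the differential \<open>F\<^sub>i\<^sub>+\<^sub>1 \<rightarrow> F\<^sub>i\<close>, and the row vector \<open>g\<close> represents the
  augmentation \<open>F\<^sub>0 \<rightarrow> I\<close>. The homogeneity conditions say that all maps preserve degrees.\<close>

definition graded_free_resolution ::
  "('v::finite, 'k::field) mpoly set \<Rightarrow> (nat \<Rightarrow> int list) \<Rightarrow> ('v, 'k) mpoly vec
    \<Rightarrow> (nat \<Rightarrow> ('v, 'k) mpoly mat) \<Rightarrow> bool" where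
  "graded_free_resolution I D g A \<longleftrightarrow>
     g \<in> carrier_vec (length (D 0)) \<and>
     (\<forall>k<length (D 0). homogeneous (D 0 ! k) (g $ k)) \<and>
     (\<forall>i. A i \<in> carrier_mat (length (D i)) (length (D (Suc i)))) \<and>
     (\<forall>i. \<forall>r<length (D i). \<forall>c<length (D (Suc i)).
        homogeneous (D (Suc i) ! c - D i ! r) (A i $$ (r, c))) \<and>
     {g \<bullet> v | v. v \<in> carrier_vec (length (D 0))} = I \<and>
     {v \<in> carrier_vec (length (D 0)). g \<bullet> v = 0} =
       {A 0 *\<^sub>v w | w. w \<in> carrier_vec (length (D 1))} \<and>
     (\<forall>i. {v \<in> carrier_vec (length (D (Suc i))). A i *\<^sub>v v = 0\<^sub>v (length (D i))} =
       {A (Suc i) *\<^sub>v w | w. w \<in> carrier_vec (length (D (Suc (Suc i))))})"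

text \<open>Tensoring with \<open>K = S/(x\<^sub>1, \<dots>, x\<^sub>n)\<close> turns \<open>F\<^sub>i\<close> into \<open>K\<^sup>b\<close> for \<open>b = length (D i)\<close>, with the
  \<open>k\<close>-th basis vector in degree \<open>D i ! k\<close>, and replaces every matrix entry by its residue class,
  i.e. by its constant coefficient.\<close>

definition residue_mat :: "('v, 'k::field) mpoly mat \<Rightarrow> 'k mat" where
  "residue_mat M = map_mat (\<lambda>f. Poly_Mapping.lookup f 0) M"

definition graded_piece :: "int list \<Rightarrow> int \<Rightarrow> 'k::field vec set" where
  "graded_piece ds j = {v \<in> carrier_vec (length ds). \<forall>k<length ds. ds ! k \<noteq> j \<longrightarrow> v $ k = 0}"

text \<open>The degree \<open>j\<close> parts of the cycles and boundaries of \<open>F \<otimes> K\<close> in homological degree \<open>i\<close>.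
  The augmentation is not part of this complex, so everything is a cycle for \<open>i = 0\<close>.\<close>

primrec tor_cycles ::
  "(nat \<Rightarrow> int list) \<Rightarrow> (nat \<Rightarrow> ('v, 'k::field) mpoly mat) \<Rightarrow> nat \<Rightarrow> int \<Rightarrow> 'k vec set" where
  "tor_cycles D A 0 j = graded_piece (D 0) j"
| "tor_cycles D A (Suc i) j =
     {v \<in> graded_piece (D (Suc i)) j. residue_mat (A i) *\<^sub>v v = 0\<^sub>v (length (D i))}"

definition tor_boundaries ::
  "(nat \<Rightarrow> int list) \<Rightarrow> (nat \<Rightarrow> ('v, 'k::field) mpoly mat) \<Rightarrow> nat \<Rightarrow> int \<Rightarrow> 'k vec set" where
  "tor_boundaries D A i j = {residue_mat (A i) *\<^sub>v w | w. w \<in> graded_piece (D (Suc i)) j}"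

text \<open>\<open>Tor\<^sub>i(I, K)\<^sub>j \<noteq> 0\<close> for a homogeneous ideal \<open>I\<close>. Resolutions as above exist by Hilbert's basis
  theorem, and whether the homology vanishes does not depend on the chosen one.\<close>

definition tor_nonzero :: "('v::finite, 'k::field) mpoly set \<Rightarrow> nat \<Rightarrow> int \<Rightarrow> bool" where
  "tor_nonzero I i j \<longleftrightarrow>
     (\<forall>D g A. graded_free_resolution I D g A \<longrightarrow> tor_cycles D A i j \<noteq> tor_boundaries D A i j)"

text \<open>The supremum is a maximum if \<open>I \<noteq> 0\<close>, since a finite free resolution exists by Hilbert's
  syzygy theorem. The zero ideal gets regularity \<open>-\<infinity>\<close>.\<close>

definition reg :: "('v::finite, 'k::field) mpoly set \<Rightarrow> ereal" where
  "reg I = Sup {ereal (real_of_int (j - int i)) | i j. tor_nonzero I i j}"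

end

theory Submission
  imports Defs
begin

text \<open>Let \<open>u \<in> I\<close> be a monomial of degree at least \<open>e\<close>, let \<open>m = m(u)\<close> and \<open>i < m\<close>, and suppose that
  \<open>v = x\<^sub>i u / x\<^sub>m\<close> is not in \<open>I\<close>. Since \<open>x\<^sub>m v \<in> I\<close> and \<open>I\<close> is of Borel type, some power of
  \<open>(x\<^sub>1, \<dots>, x\<^sub>m)\<close> multiplies \<open>v\<close> into \<open>I\<close>, so \<open>v\<close> has a monomial multiple \<open>w \<notin> I\<close> in the variables
  \<open>x\<^sub>1, \<dots>, x\<^sub>m\<close> with \<open>x\<^sub>j w \<in> I\<close> for all \<open>j \<le> m\<close>. The Koszul cycle \<open>w e\<^sub>1 \<and> \<dots> \<and> e\<^sub>m\<close> over \<open>S/I\<close> is not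
  a boundary, because \<open>w\<close> involves only the first \<open>m\<close> variables. It gives a nonzero element of
  \<open>Tor\<^sub>m\<^sub>-\<^sub>1(I, K)\<close> in degree \<open>deg w + m\<close>, so that \<open>reg I \<ge> deg w + 1 > e\<close>, a contradiction.

  Tor is computed here from a free resolution. The passage to Koszul homology is made by a diagram
  chase in the tensor product of the resolution and the Koszul complex, which is exact apart from
  the constants in degree 0.\<close>

section \<open>Coefficients and homogeneous components\<close>

declare One_nat_def [simp del]

abbreviation unit_exp :: "'v \<Rightarrow> ('v \<Rightarrow>\<^sub>0 nat)" where
  "unit_exp i \<equiv> Poly_Mapping.single i 1"

lemma lookup_single_times_add:
  fixes f :: "'a::cancel_comm_monoid_add \<Rightarrow>\<^sub>0 'b::semiring_0"
  shows "Poly_Mapping.lookup (Poly_Mapping.single s c * f) (s + a) = c * Poly_Mapping.lookup f a"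
  by (simp add: lookup_mult lookup_single when_mult eq_commute[of s])

lemma lookup_Var_times_add:
  "Poly_Mapping.lookup (Var i * f) (unit_exp i + a) = Poly_Mapping.lookup f a"
  by (simp add: Var_def monomial_def lookup_single_times_add)

lemma lookup_Var_times_eq_0:
  assumes "Poly_Mapping.lookup a i = 0"
  shows "Poly_Mapping.lookup (Var i * f) a = 0"
proof (rule ccontr)
  assume "Poly_Mapping.lookup (Var i * f) a \<noteq> 0"
  then have "a \<in> Poly_Mapping.keys (Var i * f)"
    by (simp add: in_keys_iff)
  then have "a \<in> {s + b | s b. s \<in> Poly_Mapping.keys (Var i :: ('a, 'b) mpoly) \<and> b \<in> Poly_Mapping.keys f}"
    using keys_mult by blast
  with assms show False
    by (auto simp: Var_def monomial_def lookup_add)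
qed

lemma exp_eq_unit_add:
  fixes a :: "'v \<Rightarrow>\<^sub>0 nat"
  assumes "Poly_Mapping.lookup a i \<noteq> 0"
  shows "unit_exp i + (a - unit_exp i) = a"
  using assms by (auto intro!: poly_mapping_eqI simp: lookup_add lookup_minus lookup_single when_def)

lemma mdeg_add: "mdeg (s + t) = mdeg s + mdeg t"
  by (simp add: mdeg_def lookup_add sum.distrib)

lemma mdeg_unit_exp [simp]: "mdeg (unit_exp i) = 1"
  by (simp add: mdeg_def lookup_single when_def)

lemma mdeg_0 [simp]: "mdeg 0 = 0"
  by (simp add: mdeg_def)

section \<open>Homogeneous polynomials and their components\<close>

lemma homogeneous_0 [simp]: "homogeneous d 0"
  by (simp add: homogeneous_def)

lemma homogeneous_add:
  "homogeneous d f \<Longrightarrow> homogeneous d g \<Longrightarrow> homogeneous d (f + g)"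
  using keys_add[of f g] by (auto simp: homogeneous_def)

lemma homogeneous_sum:
  "(\<And>i. i \<in> A \<Longrightarrow> homogeneous d (f i)) \<Longrightarrow> homogeneous d (sum f A)"
  by (induction A rule: infinite_finite_induct) (auto intro: homogeneous_add)

lemma homogeneous_mult:
  assumes "homogeneous d f" "homogeneous d' g" "d + d' = d''"
  shows "homogeneous d'' (f * g)"
  using assms keys_mult[of f g] by (fastforce simp: homogeneous_def mdeg_add)

lemma homogeneous_monomial: "homogeneous (int (mdeg t)) (monomial t)"
  by (simp add: homogeneous_def monomial_def)

lemma homogeneous_Var: "homogeneous 1 (Var i)"
  using homogeneous_monomial[of "unit_exp i"] by (simp add: Var_def)

definition hom_comp :: "int \<Rightarrow> ('v::finite, 'k::field) mpoly \<Rightarrow> ('v, 'k) mpoly" where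
  "hom_comp d f = Poly_Mapping.mapp (\<lambda>t c. c when int (mdeg t) = d) f"

lemma lookup_hom_comp:
  "Poly_Mapping.lookup (hom_comp d f) t = (Poly_Mapping.lookup f t when int (mdeg t) = d)"
  by (auto simp: hom_comp_def lookup_mapp when_def in_keys_iff)

lemma homogeneous_hom_comp: "homogeneous d (hom_comp d f)"
  by (auto simp: homogeneous_def in_keys_iff lookup_hom_comp)

lemma hom_comp_homogeneous: "homogeneous d f \<Longrightarrow> hom_comp d f = f"
  by (rule poly_mapping_eqI) (auto simp: lookup_hom_comp when_def homogeneous_def in_keys_iff)

lemma hom_comp_add: "hom_comp d (f + g) = hom_comp d f + hom_comp d g"
  by (rule poly_mapping_eqI) (auto simp: lookup_hom_comp lookup_add when_def)

lemma hom_comp_0 [simp]: "hom_comp d 0 = 0"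
  by (rule poly_mapping_eqI) (auto simp: lookup_hom_comp)

lemma hom_comp_sum: "hom_comp d (sum f A) = (\<Sum>i\<in>A. hom_comp d (f i))"
  by (induction A rule: infinite_finite_induct) (auto simp: hom_comp_add)

lemma poly_mapping_single_induct [case_names zero add]:
  fixes f :: "'a \<Rightarrow>\<^sub>0 'b::comm_monoid_add"
  assumes "P 0" and "\<And>t c g. P g \<Longrightarrow> P (Poly_Mapping.single t c + g)"
  shows "P f"
proof (induction f rule: update_induct)
  case const
  then show ?case by (rule assms(1))
next
  case (update f t c)
  have "Poly_Mapping.update t c f = Poly_Mapping.single t c + f"
    using update(1) by (intro poly_mapping_eqI)
      (auto simp: lookup_update lookup_add lookup_single in_keys_iff)
  with assms(2) update show ?case by simp
qed

lemma hom_comp_eq_0: "homogeneous d f \<Longrightarrow> d \<noteq> d' \<Longrightarrow> hom_comp d' f = 0"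
  by (rule poly_mapping_eqI) (auto simp: lookup_hom_comp when_def homogeneous_def in_keys_iff)

text \<open>Both sides are additive in \<open>g\<close>, so a single term suffices; its product with
  \<open>f\<close> is homogeneous, and both sides keep it or drop it together.\<close>

lemma hom_comp_mult:
  assumes "homogeneous d f"
  shows "hom_comp d' (f * g) = f * hom_comp (d' - d) g"
proof (induction g rule: poly_mapping_single_induct)
  case zero
  show ?case by simp
next
  case (add t c g)
  have t: "homogeneous (int (mdeg t)) (Poly_Mapping.single t c)"
    by (auto simp: homogeneous_def)
  have "homogeneous (d + int (mdeg t)) (f * Poly_Mapping.single t c)"
    by (intro homogeneous_mult[OF assms t]) simp
  then have "hom_comp d' (f * Poly_Mapping.single t c)
      = f * hom_comp (d' - d) (Poly_Mapping.single t c)"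
    using t by (cases "int (mdeg t) = d' - d")
      (auto simp: hom_comp_homogeneous hom_comp_eq_0 algebra_simps)
  then show ?case
    using add by (simp add: hom_comp_add distrib_left)
qed

section \<open>The Koszul complex\<close>

text \<open>The quotient of \<open>f\<close> by \<open>x\<^sub>i\<close>; terms not divisible by \<open>x\<^sub>i\<close> are dropped.\<close>

definition div_var :: "'v \<Rightarrow> ('v, 'k::field) mpoly \<Rightarrow> ('v, 'k) mpoly" where
  "div_var i f = Poly_Mapping.map_key (\<lambda>a. unit_exp i + a) f"

lemma lookup_div_var:
  "Poly_Mapping.lookup (div_var i f) a = Poly_Mapping.lookup f (unit_exp i + a)"
  unfolding div_var_def by (subst map_key.rep_eq) (auto simp: inj_def)

lemma div_var_add: "div_var i (f + g) = div_var i f + div_var i g"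
  by (rule poly_mapping_eqI) (simp add: lookup_div_var lookup_add)

lemma div_var_0 [simp]: "div_var i 0 = 0"
  by (rule poly_mapping_eqI) (simp add: lookup_div_var)

lemma div_var_sum: "div_var i (sum f A) = (\<Sum>j\<in>A. div_var i (f j))"
  by (induction A rule: infinite_finite_induct) (auto simp: div_var_add)

lemma div_var_uminus: "div_var i (- f) = - div_var i f"
  by (rule poly_mapping_eqI) (simp add: lookup_div_var)

lemma div_var_Var_times [simp]: "div_var i (Var i * f) = f"
  by (rule poly_mapping_eqI) (simp add: lookup_div_var lookup_Var_times_add)

lemma div_var_Var_times_other:
  assumes "i \<noteq> j"
  shows "div_var i (Var j * f) = Var j * div_var i f"
proof (rule poly_mapping_eqI)
  fix a
  show "Poly_Mapping.lookup (div_var i (Var j * f)) a = Poly_Mapping.lookup (Var j * div_var i f) a"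
  proof (cases "Poly_Mapping.lookup a j = 0")
    case True
    with assms show ?thesis
      by (simp add: lookup_div_var lookup_Var_times_eq_0 lookup_add lookup_single)
  next
    case False
    then obtain b where a: "a = unit_exp j + b"
      using exp_eq_unit_add by metis
    show ?thesis
      by (simp add: a lookup_div_var lookup_Var_times_add add.left_commute[of "unit_exp i"])
  qed
qed

lemma lookup_minus_Var_div_var:
  "Poly_Mapping.lookup (f - Var i * div_var i f) a =
    (if Poly_Mapping.lookup a i = 0 then Poly_Mapping.lookup f a else 0)"
proof (cases "Poly_Mapping.lookup a i = 0")
  case True
  then show ?thesis
    by (simp add: lookup_minus lookup_Var_times_eq_0)
next
  case False
  then obtain b where a: "a = unit_exp i + b"
    using exp_eq_unit_add by metis
  show ?thesis
    by (simp add: a lookup_minus lookup_Var_times_add lookup_div_var lookup_add)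
qed

text \<open>The sign of moving e_i to its place in e_i wedge e_G, the factors of e_G being in
  increasing order.\<close>

definition koszul_sign :: "'v::{finite,linorder} \<Rightarrow> 'v set \<Rightarrow> ('v, 'k::field) mpoly" where
  "koszul_sign i G = (- 1) ^ card {j \<in> G. j < i}"

lemma koszul_sign_cases:
  "koszul_sign i G = (1 :: ('v::{finite,linorder}, 'k::field) mpoly) \<or>
    koszul_sign i G = (- 1 :: ('v, 'k) mpoly)"
  by (cases "even (card {j \<in> G. j < i})") (simp_all add: koszul_sign_def)

lemma koszul_sign_square [simp]:
  "koszul_sign i G * koszul_sign i G = (1 :: ('v::{finite,linorder}, 'k::field) mpoly)"
  using koszul_sign_cases[of i G, where 'k = 'k] by (elim disjE) (simp_all only: mult_minus1 minus_minus mult_1_left)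

lemma koszul_sign_insert:
  assumes "j \<notin> G"
  shows "koszul_sign i (insert j G) = (if j < i then - koszul_sign i G else koszul_sign i G)"
proof -
  have "{k \<in> insert j G. k < i} = (if j < i then insert j {k \<in> G. k < i} else {k \<in> G. k < i})"
    by auto
  with assms show ?thesis
    by (simp add: koszul_sign_def)
qed

text \<open>Inserting the smaller index flips the sign of the larger one, but not conversely. This
  makes the Koszul differential square to zero.\<close>

lemma koszul_sign_swap:
  assumes "i \<notin> G" "j \<notin> G" "i \<noteq> j"
  shows "koszul_sign i G * koszul_sign j (insert i G) =
    - (koszul_sign j G * koszul_sign i (insert j G) :: ('v::{finite,linorder}, 'k::field) mpoly)"
  using assms by (cases i j rule: linorder_cases) (simp_all add: koszul_sign_insert)

lemma div_var_koszul_sign: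
  fixes f :: "('v::{finite,linorder}, 'k::field) mpoly"
  shows "div_var i (koszul_sign j G * f) = koszul_sign j G * div_var i f"
  using koszul_sign_cases[of j G, where 'k = 'k] by (elim disjE) (simp_all only: div_var_uminus mult_minus1 mult_1_left)

lemma homogeneous_uminus: "homogeneous d f \<Longrightarrow> homogeneous d (- f)"
  by (auto simp: homogeneous_def in_keys_iff)

lemma homogeneous_koszul_sign:
  fixes f :: "('v::{finite,linorder}, 'k::field) mpoly"
  shows "homogeneous d f \<Longrightarrow> homogeneous d (koszul_sign i G * f)"
  using koszul_sign_cases[of i G, where 'k = 'k] by (elim disjE) (simp_all only: homogeneous_uminus mult_minus1 mult_1_left)

text \<open>An element \<open>\<Sum>\<^sub>G f\<^sub>G e\<^sub>G\<close> of the Koszul complex on all the variables is encoded by the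
  function \<open>f\<close>; all homological degrees \<open>card G\<close> are treated at once.\<close>

definition koszul :: "('v::{finite,linorder} set \<Rightarrow> ('v, 'k::field) mpoly) \<Rightarrow> 'v set \<Rightarrow> ('v, 'k) mpoly"
  where "koszul f G = (\<Sum>i\<in>-G. koszul_sign i G * (Var i * f (insert i G)))"

lemma koszul_add: "koszul (\<lambda>G. f G + g G) G = koszul f G + koszul g G"
  by (simp add: koszul_def distrib_left sum.distrib)

lemma koszul_diff: "koszul (\<lambda>G. f G - g G) G = koszul f G - koszul g G"
  by (simp add: koszul_def right_diff_distrib sum_subtractf)

lemma koszul_0 [simp]: "koszul (\<lambda>G. 0) G = 0"
  by (simp add: koszul_def)

lemma koszul_sum: "koszul (\<lambda>G. \<Sum>c\<in>A. f c G) G = (\<Sum>c\<in>A. koszul (f c) G)"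
  by (induction A rule: infinite_finite_induct) (auto simp: koszul_add)

lemma koszul_mult: "koszul (\<lambda>G. a * f G) G = a * koszul f G"
  by (simp add: koszul_def sum_distrib_left mult.left_commute)

lemma koszul_cong:
  "(\<And>i. i \<notin> G \<Longrightarrow> f (insert i G) = g (insert i G)) \<Longrightarrow> koszul f G = koszul g G"
  unfolding koszul_def by (intro sum.cong) auto

lemma koszul_eq_0:
  "(\<And>i. i \<notin> G \<Longrightarrow> f (insert i G) = 0) \<Longrightarrow> koszul f G = 0"
  using koszul_cong[of G f "\<lambda>G. 0"] by simp

lemma lookup_koszul_eq_0:
  fixes f :: "'v::{finite,linorder} set \<Rightarrow> ('v, 'k::field) mpoly"
  assumes "\<And>i. i \<notin> G \<Longrightarrow> Poly_Mapping.lookup a i = 0"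
  shows "Poly_Mapping.lookup (koszul f G) a = 0"
proof -
  have "Poly_Mapping.lookup (koszul_sign i G * (Var i * f (insert i G))) a = 0" if "i \<notin> G" for i
    using koszul_sign_cases[of i G, where 'k = 'k] lookup_Var_times_eq_0[OF assms[OF that], of "f (insert i G)"]
    by (elim disjE) (simp_all only: mult_minus1 mult_1_left lookup_uminus neg_equal_0_iff_equal)
  then show ?thesis
    by (simp add: koszul_def lookup_sum)
qed

lemma homogeneous_koszul:
  assumes "\<And>i. i \<notin> G \<Longrightarrow> homogeneous (d - 1) (f (insert i G))"
  shows "homogeneous d (koszul f G)"
  unfolding koszul_def
  by (intro homogeneous_sum homogeneous_koszul_sign homogeneous_mult[OF homogeneous_Var assms]) auto

lemma koszul_koszul:
  fixes f :: "'v::{finite,linorder} set \<Rightarrow> ('v, 'k::field) mpoly"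
  shows "koszul (koszul f) G = 0"
proof -
  \<comment> \<open>The contribution of the ordered pair (i, j). By antisymmetry the terms with j <
    i cancel those with i < j.\<close>
  define a where "a i j = koszul_sign i G * koszul_sign j (insert i G)
    * (Var i * (Var j * f (insert i (insert j G))))" for i j
  have anti: "a i j = - a j i" if "i \<in> -G" "j \<in> -G" "i \<noteq> j" for i j
    using that koszul_sign_swap[of i G j, where 'k = 'k]
    by (simp add: a_def insert_commute[of i j] mult.left_commute[of "Var i" "Var j"])
  have "koszul (koszul f) G = (\<Sum>i\<in>-G. \<Sum>j\<in>-G - {i}. a i j)"
    unfolding koszul_def a_def
    by (intro sum.cong refl)
      (auto simp: sum_distrib_left mult_ac insert_commute intro!: sum.cong)
  also have "\<dots> = (\<Sum>i\<in>-G. \<Sum>j\<in>{j\<in>-G. j < i}. a i j) + (\<Sum>i\<in>-G. \<Sum>j\<in>{j\<in>-G. i < j}. a i j)"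
    unfolding sum.distrib[symmetric]
    by (intro sum.cong refl, subst sum.union_disjoint[symmetric]) (auto intro!: sum.cong)
  also have "(\<Sum>i\<in>-G. \<Sum>j\<in>{j\<in>-G. i < j}. a i j) = (\<Sum>j\<in>-G. \<Sum>i\<in>{i\<in>-G. i < j}. a i j)"
    using sum.swap_restrict[of "-G" "-G" a "\<lambda>i j. i < j"] by simp
  also have "\<dots> = (\<Sum>j\<in>-G. \<Sum>i\<in>{i\<in>-G. i < j}. - a j i)"
    by (intro sum.cong refl anti) auto
  finally show ?thesis
    by (simp add: sum_negf)
qed

text \<open>The map f \<mapsto> e_i wedge (f / x_i), a contracting homotopy for the Koszul complex
  of x_i alone.\<close>

definition koszul_homotopy ::
  "'v::{finite,linorder} \<Rightarrow> ('v set \<Rightarrow> ('v, 'k::field) mpoly) \<Rightarrow> 'v set \<Rightarrow> ('v, 'k) mpoly" where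
  "koszul_homotopy i f G =
     (if i \<in> G then koszul_sign i (G - {i}) * div_var i (f (G - {i})) else 0)"

text \<open>On a cycle only the summand d h of the homotopy formula d h + h d remains. It returns
  the cycle except for the terms free of both e_i and x_i.\<close>

lemma koszul_koszul_homotopy:
  fixes f :: "'v::{finite,linorder} set \<Rightarrow> ('v, 'k::field) mpoly"
  assumes "\<And>G. koszul f G = 0"
  shows "koszul (koszul_homotopy i f) G = (if i \<in> G then f G else Var i * div_var i (f G))"
proof (cases "i \<in> G")
  case True
  then obtain H where H: "G = insert i H" "i \<notin> H"
    by (metis mk_disjoint_insert)
  \<comment> \<open>Divide the cycle condition at \<open>H\<close> by x_i: the summand for i becomes
    \<open>f G\<close> up to sign, and the others form the left-hand side up to sign.\<close>
  have "0 = div_var i (koszul f H)"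
    by (simp add: assms)
  also have "\<dots> = (\<Sum>j\<in>-H. koszul_sign j H * div_var i (Var j * f (insert j H)))"
    by (simp add: koszul_def div_var_sum div_var_koszul_sign)
  also have "-H = insert i (-G)"
    using H by auto
  also have "(\<Sum>j\<in>\<dots>. koszul_sign j H * div_var i (Var j * f (insert j H))) =
      koszul_sign i H * f G + (\<Sum>j\<in>-G. koszul_sign j H * (Var j * div_var i (f (insert j H))))"
    using H by (subst sum.insert) (auto simp: div_var_Var_times_other intro!: sum.cong)
  finally have *: "(\<Sum>j\<in>-G. koszul_sign j H * (Var j * div_var i (f (insert j H))))
      = - (koszul_sign i H * f G)"
    by (simp add: eq_neg_iff_add_eq_0 add.commute)
  have sgn: "koszul_sign j G * koszul_sign i (insert j H) = - (koszul_sign i H * koszul_sign j H :: ('v, 'k) mpoly)"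
    if "j \<in> -G" for j
    using that H koszul_sign_cases[of i H, where 'k = 'k] koszul_sign_cases[of j H, where 'k = 'k]
    by (cases i j rule: linorder_cases) (auto simp: koszul_sign_insert)
  have "koszul (koszul_homotopy i f) G = (\<Sum>j\<in>-G. koszul_sign j G *
      (Var j * (koszul_sign i (insert j H) * div_var i (f (insert j H)))))"
    unfolding koszul_def
  proof (intro sum.cong refl)
    fix j assume "j \<in> -G"
    then have "insert j G - {i} = insert j H" "i \<in> insert j G"
      using H by auto
    then show "koszul_sign j G * (Var j * koszul_homotopy i f (insert j G)) =
        koszul_sign j G * (Var j * (koszul_sign i (insert j H) * div_var i (f (insert j H))))"
      by (simp add: koszul_homotopy_def)
  qed
  also have "\<dots> = (\<Sum>j\<in>-G. (koszul_sign j G * koszul_sign i (insert j H)) *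
      (Var j * div_var i (f (insert j H))))"
    by (simp add: mult_ac)
  also have "\<dots> = - koszul_sign i H * (\<Sum>j\<in>-G. koszul_sign j H * (Var j * div_var i (f (insert j H))))"
    by (simp add: sgn sum_distrib_left mult_ac sum_negf)
  also have "\<dots> = f G"
    unfolding * by (simp flip: mult.assoc)
  finally show ?thesis
    using True by simp
next
  case False
  have "koszul (koszul_homotopy i f) G =
      (\<Sum>j\<in>{i}. koszul_sign j G * (Var j * koszul_homotopy i f (insert j G)))"
    unfolding koszul_def using False
    by (intro sum.mono_neutral_right) (auto simp: koszul_homotopy_def)
  also have "\<dots> = (koszul_sign i G * koszul_sign i G) * (Var i * div_var i (f G))"
    using False by (simp only: koszul_homotopy_def) (simp add: mult_ac del: koszul_sign_square)
  finally show ?thesis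
    using False by simp
qed

text \<open>Each application of \<open>koszul_homotopy i\<close> removes from a cycle everything that involves
  the variable \<open>x\<^sub>i\<close>, as a coefficient or in the exterior part.\<close>

lemma koszul_reduce:
  fixes f :: "'v::{finite,linorder} set \<Rightarrow> ('v, 'k::field) mpoly"
  assumes "\<And>G. koszul f G = 0"
  shows "\<exists>g. \<forall>G a. (G \<inter> V \<noteq> {} \<or> (\<exists>i\<in>V. Poly_Mapping.lookup a i \<noteq> 0)
    \<longrightarrow> Poly_Mapping.lookup (f G - koszul g G) a = 0)"
  using finite[of V]
proof (induction V rule: finite_induct)
  case empty
  show ?case by simp
next
  case (insert i V)
  then obtain g where g: "\<And>G a. G \<inter> V \<noteq> {} \<or> (\<exists>i\<in>V. Poly_Mapping.lookup a i \<noteq> 0)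
    \<Longrightarrow> Poly_Mapping.lookup (f G - koszul g G) a = 0"
    by metis
  \<comment> \<open>The remainder \<open>f'\<close> is again a cycle, so the homotopy for x_i
    applies to it. It only deletes terms of \<open>f'\<close>, so nothing gained for
    \<open>V\<close> is lost.\<close>
  define f' where "f' G = f G - koszul g G" for G
  have "koszul f' G = 0" for G
    unfolding f'_def koszul_diff by (simp add: assms koszul_koszul)
  then have h: "koszul (koszul_homotopy i f') G = (if i \<in> G then f' G else Var i * div_var i (f' G))" for G
    by (rule koszul_koszul_homotopy)
  let ?g = "\<lambda>G. g G + koszul_homotopy i f' G"
  have g': "f G - koszul ?g G = (if i \<in> G then 0 else f' G - Var i * div_var i (f' G))" for G
    by (simp add: koszul_add h f'_def)
  show ?case
  proof (intro exI[of _ ?g] allI impI)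
    fix G and a :: "'v \<Rightarrow>\<^sub>0 nat"
    assume a: "G \<inter> insert i V \<noteq> {} \<or> (\<exists>j\<in>insert i V. Poly_Mapping.lookup a j \<noteq> 0)"
    show "Poly_Mapping.lookup (f G - koszul ?g G) a = 0"
      unfolding g' using a g[of G a] by (auto simp: lookup_minus_Var_div_var f'_def)
  qed
qed

text \<open>Once all variables are removed, only the constant term at the empty set could survive.
  It is 0 in \<open>f\<close> by assumption and in every boundary by divisibility.\<close>

lemma koszul_exact:
  assumes "\<And>G. koszul f G = 0" and "Poly_Mapping.lookup (f {}) 0 = 0"
  obtains g where "\<And>G. f G = koszul g G"
proof -
  obtain g where g: "\<And>G a. G \<noteq> {} \<or> (\<exists>i. Poly_Mapping.lookup a i \<noteq> 0)
    \<Longrightarrow> Poly_Mapping.lookup (f G - koszul g G) a = 0"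
    using koszul_reduce[of f UNIV] assms(1) by auto
  have "Poly_Mapping.lookup (f G - koszul g G) a = 0" for G a
  proof (cases "G = {} \<and> a = 0")
    case True
    then show ?thesis
      using assms(2) by (simp add: lookup_minus lookup_koszul_eq_0)
  next
    case False
    then show ?thesis
      by (intro g) (metis lookup_zero poly_mapping_eqI)
  qed
  then have "f G - koszul g G = 0" for G
    by (intro poly_mapping_eqI) simp
  then have "f G = koszul g G" for G
    by (simp only: right_minus_eq)
  then show ?thesis
    by (rule that)
qed

section \<open>The Koszul complex with coefficients in a resolution\<close>

definition mat_app :: "nat \<Rightarrow> ('a \<Rightarrow> nat \<Rightarrow> 'b::comm_ring_1) \<Rightarrow> (nat \<Rightarrow> 'b) \<Rightarrow> 'a \<Rightarrow> 'b" where
  "mat_app n A u r = (\<Sum>c<n. A r c * u c)"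

lemma mat_app_diff: "mat_app n A (\<lambda>c. u c - v c) r = mat_app n A u r - mat_app n A v r"
  by (simp add: mat_app_def right_diff_distrib sum_subtractf)

lemma mat_app_0 [simp]: "mat_app n A (\<lambda>c. 0) r = 0"
  by (simp add: mat_app_def)

lemma mat_app_cong: "(\<And>c. c < n \<Longrightarrow> u c = v c) \<Longrightarrow> mat_app n A u r = mat_app n A v r"
  by (simp add: mat_app_def)

text \<open>The Koszul differential is linear over the polynomial ring, so the two differentials of
  the double complex commute, without a sign.\<close>

lemma koszul_mat_app:
  "koszul (\<lambda>G. mat_app n A (u G) r) G = mat_app n A (\<lambda>c. koszul (\<lambda>G. u G c) G) r"
  by (simp add: mat_app_def koszul_sum koszul_mult)

text \<open>A free resolution with its augmentation, as it occurs in \<^const>\<open>graded_free_resolution\<close>, but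
  with vectors and matrices written as functions and without the requirement that \<open>M 0\<close> be onto.\<close>

locale graded_exact_complex =
  fixes E :: "nat \<Rightarrow> int list"
    and M :: "nat \<Rightarrow> nat \<Rightarrow> nat \<Rightarrow> ('v::{finite,linorder}, 'k::field) mpoly"
  assumes hom: "r < length (E q) \<Longrightarrow> c < length (E (Suc q)) \<Longrightarrow>
      homogeneous (E (Suc q) ! c - E q ! r) (M q r c)"
    and complex: "r < length (E q) \<Longrightarrow>
      mat_app (length (E (Suc q))) (M q) (mat_app (length (E (Suc (Suc q)))) (M (Suc q)) w) r = 0"
    and exact: "(\<And>r. r < length (E q) \<Longrightarrow> mat_app (length (E (Suc q))) (M q) u r = 0) \<Longrightarrow>
      \<exists>w. \<forall>c<length (E (Suc q)). u c = mat_app (length (E (Suc (Suc q)))) (M (Suc q)) w c"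
begin

abbreviation app :: "nat \<Rightarrow> (nat \<Rightarrow> ('v, 'k) mpoly) \<Rightarrow> nat \<Rightarrow> ('v, 'k) mpoly" where
  "app q \<equiv> mat_app (length (E (Suc q))) (M q)"

text \<open>The coordinates of a lift may be replaced by their components of the right degrees,
  because the homogeneous entries of \<open>M q\<close> carry components to components.\<close>

lemma homogeneous_lift:
  assumes u: "\<And>r. r < length (E q) \<Longrightarrow> u r = app q w r"
    and d: "\<And>r. r < length (E q) \<Longrightarrow> homogeneous (d - E q ! r) (u r)"
  shows "\<exists>w'. (\<forall>r<length (E q). u r = app q w' r) \<and>
    (\<forall>c<length (E (Suc q)). homogeneous (d - E (Suc q) ! c) (w' c))"
proof (intro exI conjI allI impI)
  let ?w' = "\<lambda>c. hom_comp (d - E (Suc q) ! c) (w c)"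
  fix r assume r: "r < length (E q)"
  have "u r = hom_comp (d - E q ! r) (app q w r)"
    using u d r by (metis hom_comp_homogeneous)
  also have "\<dots> = app q ?w' r"
    using r by (simp add: mat_app_def hom_comp_sum hom_comp_mult[OF hom[OF r]])
  finally show "u r = app q ?w' r" .
qed (rule homogeneous_hom_comp)

text \<open>The zigzag in the double complex formed by the Koszul complex and the complex \<open>M\<close>: the chain
  \<open>C q\<close> has values in the \<open>q\<close>-th module, and \<open>C m\<close> consists of a single element of the \<open>m\<close>-th
  module, which represents the Tor class of \<open>z\<close>.\<close>

lemma koszul_lifts:
  fixes z :: "'v set \<Rightarrow> nat \<Rightarrow> ('v, 'k) mpoly"
  assumes supp: "\<And>G r. card G > m \<Longrightarrow> z G r = 0"
    and hom_z: "\<And>G r. r < length (E 0) \<Longrightarrow> homogeneous (N - int (card G) - E 0 ! r) (z G r)"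
    and lift: "\<And>G. \<exists>u. \<forall>r<length (E 0). koszul (\<lambda>G. z G r) G = app 0 u r"
  obtains C where "C 0 = z"
    and "\<And>q G r. card G > m - q \<Longrightarrow> C q G r = 0"
    and "\<And>q G r. r < length (E q) \<Longrightarrow> homogeneous (N - int (card G) - E q ! r) (C q G r)"
    and "\<And>q G r. r < length (E q) \<Longrightarrow> koszul (\<lambda>G. C q G r) G = app q (C (Suc q) G) r"
proof -
  \<comment> \<open>The invariant of level \<open>q\<close>: \<open>N\<close> is the total degree,
    with e_G in degree \<open>card G\<close>; the last clause, liftability of the Koszul boundary,
    permits the next choice.\<close>
  define P where "P q x \<longleftrightarrow> (q = 0 \<longrightarrow> x = z) \<and> (\<forall>G r. card G > m - q \<longrightarrow> x G r = 0) \<and>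
    (\<forall>G. \<forall>r<length (E q). homogeneous (N - int (card G) - E q ! r) (x G r)) \<and>
    (\<forall>G. \<exists>u. \<forall>r<length (E q). koszul (\<lambda>G. x G r) G = app q u r)" for q x
  define Q where "Q q x y \<longleftrightarrow>
    (\<forall>G. \<forall>r<length (E q). koszul (\<lambda>G. x G r) G = app q (y G) r)" for q x y
  have base: "P 0 z"
    using assms by (simp add: P_def)
  have step: "\<exists>y. P (Suc q) y \<and> Q q x y" if P: "P q x" for q x
  proof -
    have "\<exists>u. (\<forall>r<length (E q). koszul (\<lambda>G. x G r) G = app q u r) \<and>
        (\<forall>c<length (E (Suc q)). homogeneous (N - int (card G) - E (Suc q) ! c) (u c))" for G
    proof -
      obtain u where u: "\<And>r. r < length (E q) \<Longrightarrow> koszul (\<lambda>G. x G r) G = app q u r"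
        using P by (metis P_def)
      have "homogeneous (N - int (card G) - E q ! r) (koszul (\<lambda>G. x G r) G)"
        if r: "r < length (E q)" for r
      proof (rule homogeneous_koszul)
        fix i assume "i \<notin> G"
        then have "card (insert i G) = Suc (card G)" by simp
        moreover have "homogeneous (N - int (card (insert i G)) - E q ! r) (x (insert i G) r)"
          using P r by (simp add: P_def)
        ultimately show "homogeneous (N - int (card G) - E q ! r - 1) (x (insert i G) r)"
          by (simp add: algebra_simps)
      qed
      then show ?thesis
        using homogeneous_lift[OF u] by blast
    qed
    then obtain y where y: "\<And>G r. r < length (E q) \<Longrightarrow> koszul (\<lambda>G. x G r) G = app q (y G) r"
      and hom_y: "\<And>G c. c < length (E (Suc q)) \<Longrightarrow>
        homogeneous (N - int (card G) - E (Suc q) ! c) (y G c)"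
      by metis
    \<comment> \<open>The lifts are chosen for each \<open>G\<close> separately and may be nonzero
      in too high Koszul degree. They can be reset to 0 there, where the Koszul boundary of
      \<open>x\<close> vanishes.\<close>
    define y' where "y' G c = (if card G > m - Suc q then 0 else y G c)" for G c
    have y': "koszul (\<lambda>G. x G r) G = app q (y' G) r" if r: "r < length (E q)" for G r
    proof (cases "card G > m - Suc q")
      case True
      have "koszul (\<lambda>G. x G r) G = 0"
      proof (rule koszul_eq_0)
        fix i assume "i \<notin> G"
        with True have "card (insert i G) > m - q"
          by simp
        with P show "x (insert i G) r = 0"
          unfolding P_def by blast
      qed
      with True show ?thesis
        by (simp add: y'_def mat_app_def)
    next
      case False
      then show ?thesis
        using y r by (simp add: y'_def mat_app_def)
    qed
    \<comment> \<open>The Koszul boundary of \<open>y'\<close> maps to the double Koszul boundary of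
      \<open>x\<close>, which is 0, so exactness lifts it.\<close>
    have "\<exists>u. \<forall>c<length (E (Suc q)). koszul (\<lambda>G. y' G c) G = app (Suc q) u c" for G
    proof (rule exact)
      fix r assume r: "r < length (E q)"
      have "app q (\<lambda>c. koszul (\<lambda>G. y' G c) G) r = koszul (koszul (\<lambda>G. x G r)) G"
        by (simp only: koszul_mat_app[symmetric] y'[OF r, symmetric])
      then show "app q (\<lambda>c. koszul (\<lambda>G. y' G c) G) r = 0"
        by (simp add: koszul_koszul)
    qed
    moreover have "homogeneous (N - int (card G) - E (Suc q) ! c) (y' G c)"
      if "c < length (E (Suc q))" for G c
      using hom_y[OF that] by (simp add: y'_def)
    ultimately have "P (Suc q) y'"
      by (simp add: P_def y'_def)
    with y' show ?thesis
      unfolding Q_def by blast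
  qed
  obtain C where C: "\<And>q. P q (C q) \<and> Q q (C q) (C (Suc q))"
    using dependent_nat_choice[of P Q] base step by metis
  show thesis
    using C by (intro that[of C]) (simp_all add: P_def Q_def)
qed

text \<open>If the end of the zigzag is a boundary modulo the variables, then exactness of the Koszul
  complex propagates this back to the start, in Koszul degree at least \<open>k\<close> at level \<open>m - k\<close>.\<close>

lemma koszul_descent:
  assumes C: "\<And>q G r. r < length (E q) \<Longrightarrow> koszul (\<lambda>G. C q G r) G = app q (C (Suc q) G) r"
    and top: "\<forall>c<length (E m). Poly_Mapping.lookup (C m {} c) 0 = Poly_Mapping.lookup (app m b c) 0"
    and supp_top: "\<And>G r. G \<noteq> {} \<Longrightarrow> C m G r = 0"
    and k: "k \<le> m"
  shows "\<exists>d u. \<forall>G. card G \<ge> k \<longrightarrow> (\<forall>r<length (E (m - k)).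
    C (m - k) G r = koszul (d r) G + app (m - k) (u G) r)"
  using k
proof (induction k)
  case 0
  \<comment> \<open>Subtracting the image of \<open>b\<close> at the empty set leaves an element of
    Koszul degree 0 without constant term, hence a Koszul boundary.\<close>
  define u where "u G = (if G = {} then b else (\<lambda>c. 0))" for G :: "'v set"
  have "\<exists>d. \<forall>G. C m G r - app m (u G) r = koszul d G" if r: "r < length (E m)" for r
  proof -
    have "koszul (\<lambda>G. C m G r - app m (u G) r) G = 0" for G
      by (rule koszul_eq_0) (simp add: u_def supp_top)
    moreover have "Poly_Mapping.lookup (C m {} r - app m (u {}) r) 0 = 0"
      using top r by (simp add: u_def lookup_minus)
    ultimately show ?thesis
      using koszul_exact[of "\<lambda>G. C m G r - app m (u G) r"] by metis
  qed
  then obtain d where d: "\<And>r G. r < length (E m) \<Longrightarrow> C m G r - app m (u G) r = koszul (d r) G"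
    by metis
  show ?case
    by (intro exI[of _ d] exI[of _ u]) (auto simp: d[symmetric])
next
  case (Suc k)
  define q where "q = m - Suc k"
  have q: "m - k = Suc q"
    using Suc.prems by (simp add: q_def)
  obtain d u where du: "\<And>G r. card G \<ge> k \<Longrightarrow> r < length (E (Suc q)) \<Longrightarrow>
      C (Suc q) G r = koszul (d r) G + app (Suc q) (u G) r"
    using Suc q by auto
  \<comment> \<open>Subtracting the image of \<open>d\<close> makes the Koszul boundary of
    \<open>C q\<close> vanish at all sets with at least \<open>k\<close> elements. Cutting off below
    \<open>Suc k\<close> gives a cycle everywhere, with value 0 at the empty set, the only
    obstruction to exactness.\<close>
  define f where "f r G = (if card G \<ge> Suc k then C q G r - app q (\<lambda>c. d c G) r else 0)" for r G
  have f: "koszul (f r) G = 0" if r: "r < length (E q)" for r G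
  proof (cases "card G \<ge> k")
    case True
    have "koszul (f r) G = koszul (\<lambda>G. C q G r - app q (\<lambda>c. d c G) r) G"
      by (rule koszul_cong) (use True in \<open>simp add: f_def\<close>)
    also have "\<dots> = app q (\<lambda>c. C (Suc q) G c - koszul (d c) G) r"
      using r by (simp add: koszul_diff C koszul_mat_app mat_app_diff)
    also have "\<dots> = app q (app (Suc q) (u G)) r"
      by (rule mat_app_cong) (use du[OF True] in simp)
    finally show ?thesis
      using complex r by simp
  next
    case False
    then show ?thesis
      by (intro koszul_eq_0) (simp add: f_def)
  qed
  have "\<exists>e. \<forall>G. f r G = koszul e G" if r: "r < length (E q)" for r
    using koszul_exact[of "f r"] f[OF r] by (metis card.empty f_def lookup_zero not_less_eq_eq le0)
  then obtain e where e: "\<And>r G. r < length (E q) \<Longrightarrow> f r G = koszul (e r) G"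
    by metis
  show ?case
    unfolding q_def[symmetric]
  proof (intro exI allI impI)
    fix G :: "'v set" and r
    assume "card G \<ge> Suc k" "r < length (E q)"
    then show "C q G r = koszul (e r) G + app q ((\<lambda>G c. d c G) G) r"
      using e[of r G] by (simp add: f_def diff_eq_eq)
  qed
qed

text \<open>The class of w e_V travels along the zigzag to level \<open>m\<close>, where
  \<open>bound\<close> expresses that Tor vanishes in degree \<open>N\<close>, and back. In the
  result, all terms of \<open>koszul d V\<close> are divisible by a variable outside
  \<open>V\<close>.\<close>

lemma koszul_class_bounds:
  fixes w :: "('v, 'k) mpoly" and V :: "'v set"
  defines "m \<equiv> card V"
  assumes E0: "E 0 = [0]" and hom_w: "homogeneous (N - int m) w"
    and lift: "\<And>i. i \<in> V \<Longrightarrow> \<exists>u. Var i * w = app 0 u 0"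
    and bound: "\<And>v. \<lbrakk>\<And>c. c < length (E m) \<Longrightarrow> homogeneous (N - E m ! c) (v c);
        \<And>q r. m = Suc q \<Longrightarrow> r < length (E q) \<Longrightarrow> Poly_Mapping.lookup (app q v r) 0 = 0\<rbrakk> \<Longrightarrow>
      \<exists>b. \<forall>c<length (E m). Poly_Mapping.lookup (v c) 0 = Poly_Mapping.lookup (app m b c) 0"
  obtains d u where "w = koszul d V + app 0 u 0"
proof -
  define z where "z G r = (if G = V \<and> r = 0 then w else 0)" for G :: "'v set" and r :: nat
  \<comment> \<open>The Koszul boundary of w e_V lives at the sets \<open>V - {i}\<close> with i in
    \<open>V\<close>, where it is x_i w up to sign and \<open>lift\<close> applies.\<close>
  have lift_z: "\<exists>u. \<forall>r<length (E 0). koszul (\<lambda>G. z G r) G = app 0 u r" for G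
  proof (cases "\<exists>i\<in>V. G = V - {i}")
    case True
    then obtain i where i: "i \<in> V" "G = V - {i}"
      by blast
    obtain u where u: "Var i * w = app 0 u 0"
      using lift i by blast
    have "koszul (\<lambda>G. z G 0) G = (\<Sum>j\<in>{i}. koszul_sign j G * (Var j * z (insert j G) 0))"
      unfolding koszul_def using i by (intro sum.mono_neutral_right) (auto simp: z_def)
    also have "\<dots> = koszul_sign i G * (Var i * w)"
      using i by (simp add: z_def insert_absorb)
    also have "\<dots> = app 0 (\<lambda>c. koszul_sign i G * u c) 0"
      by (simp add: u mat_app_def sum_distrib_left mult.left_commute)
    finally show ?thesis
      using E0 by auto
  next
    case False
    have "koszul (\<lambda>G. z G r) G = 0" for r
      by (rule koszul_eq_0) (use False in \<open>auto simp: z_def\<close>)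
    then show ?thesis
      by (intro exI[of _ "\<lambda>c. 0"]) simp
  qed
  obtain C where C0: "C 0 = z"
    and supp: "\<And>q G r. card G > m - q \<Longrightarrow> C q G r = 0"
    and hom_C: "\<And>q G r. r < length (E q) \<Longrightarrow> homogeneous (N - int (card G) - E q ! r) (C q G r)"
    and C: "\<And>q G r. r < length (E q) \<Longrightarrow> koszul (\<lambda>G. C q G r) G = app q (C (Suc q) G) r"
    by (rule koszul_lifts[of m z N, OF _ _ lift_z])
      (use E0 hom_w in \<open>auto simp: z_def m_def\<close>)
  \<comment> \<open>The end \<open>C m {}\<close> has degree \<open>N\<close>. One level down it
    maps to a Koszul boundary, which has no constant term, so it is a cycle modulo the
    variables.\<close>
  have "\<exists>b. \<forall>c<length (E m). Poly_Mapping.lookup (C m {} c) 0 = Poly_Mapping.lookup (app m b c) 0"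
  proof (rule bound)
    fix c assume "c < length (E m)"
    then show "homogeneous (N - E m ! c) (C m {} c)"
      using hom_C[of c m "{}"] by simp
  next
    fix q r assume "m = Suc q" "r < length (E q)"
    then show "Poly_Mapping.lookup (app q (C m {}) r) 0 = 0"
      using C[of r q "{}"] by (metis lookup_koszul_eq_0 lookup_zero)
  qed
  then obtain b where b: "\<forall>c<length (E m).
      Poly_Mapping.lookup (C m {} c) 0 = Poly_Mapping.lookup (app m b c) 0"
    by blast
  have "G \<noteq> {} \<Longrightarrow> C m G r = 0" for G r
    by (rule supp) (simp add: card_gt_0_iff)
  then obtain d u where "\<forall>G. card G \<ge> m \<longrightarrow> (\<forall>r<length (E 0).
      C 0 G r = koszul (d r) G + app 0 (u G) r)"
    using koszul_descent[OF C b, of m] by fastforce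
  then have "z V 0 = koszul (d 0) V + app 0 (u V) 0"
    using E0 by (simp add: m_def C0)
  then show thesis
    by (intro that) (simp add: z_def)
qed

end

section \<open>Monomial ideals\<close>

lemma exp_add_eq_0_iff: "s + t = 0 \<longleftrightarrow> s = 0 \<and> t = 0" for s t :: "'v \<Rightarrow>\<^sub>0 nat"
  by (auto simp: poly_mapping_eq_iff fun_eq_iff lookup_add)

text \<open>A sum of exponent vectors is 0 only if both are. Thus the constant coefficient is the
  ring map onto K by which the resolution is tensored.\<close>

lemma lookup_mult_0:
  fixes f g :: "('v, 'k::field) mpoly"
  shows "Poly_Mapping.lookup (f * g) 0 = Poly_Mapping.lookup f 0 * Poly_Mapping.lookup g 0"
proof (induction g rule: poly_mapping_single_induct)
  case zero
  show ?case by simp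
next
  case (add t c g)
  have "Poly_Mapping.lookup (Poly_Mapping.single t c * f) 0 = Poly_Mapping.lookup f 0 * (c when t = 0)"
  proof (cases "t = 0")
    case True
    then show ?thesis
      using lookup_single_times_add[of t c f 0] by simp
  next
    case False
    have "0 \<notin> Poly_Mapping.keys (Poly_Mapping.single t c * f)"
      using keys_mult[of "Poly_Mapping.single t c" f] False
      by (auto simp: exp_add_eq_0_iff split: if_splits)
    then show ?thesis
      using False by (simp add: in_keys_iff)
  qed
  with add show ?case
    by (simp add: distrib_left lookup_add lookup_single mult.commute[of f "Poly_Mapping.single t c"])
qed

lemma ideal_gen_mult:
  assumes "f \<in> ideal_gen B"
  shows "g * f \<in> ideal_gen B"
proof -
  interpret Modules.module "(*) :: 'a \<Rightarrow> 'a \<Rightarrow> 'a"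
    by (rule module_mult)
  show ?thesis
    using assms by (rule span_scale)
qed

lemma ideal_gen_base: "f \<in> B \<Longrightarrow> f \<in> ideal_gen B"
proof -
  interpret Modules.module "(*) :: 'a \<Rightarrow> 'a \<Rightarrow> 'a"
    by (rule module_mult)
  show "f \<in> B \<Longrightarrow> f \<in> ideal_gen B"
    by (rule span_base)
qed

lemma ideal_gen_subset:
  assumes "\<And>b. b \<in> B \<Longrightarrow> b \<in> ideal_gen C" "f \<in> ideal_gen B"
  shows "f \<in> ideal_gen C"
proof -
  interpret Modules.module "(*) :: 'a \<Rightarrow> 'a \<Rightarrow> 'a"
    by (rule module_mult)
  show ?thesis
    using assms(2) by (rule span_induct) (use assms(1) in \<open>auto intro: subspace_span\<close>)
qed

lemma keys_ideal_gen_monomial: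
  assumes "f \<in> ideal_gen (monomial ` T)" "a \<in> Poly_Mapping.keys f"
  shows "\<exists>t\<in>T. \<exists>b. a = t + b"
proof -
  interpret Modules.module "(*) :: ('a, 'b) mpoly \<Rightarrow> _ \<Rightarrow> _"
    by (rule module_mult)
  have "\<forall>a\<in>Poly_Mapping.keys f. \<exists>t\<in>T. \<exists>b. a = t + b"
    using assms(1)
  proof (induction rule: span_induct_alt)
    case base
    show ?case by simp
  next
    case (step c x y)
    then obtain t where t: "t \<in> T" "x = monomial t"
      by blast
    have "\<exists>t\<in>T. \<exists>b. a = t + b" if a: "a \<in> Poly_Mapping.keys (c * x)" for a
    proof -
      have "a \<in> {s + b | s b. s \<in> Poly_Mapping.keys c \<and> b \<in> Poly_Mapping.keys x}"
        using a keys_mult by blast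
      then show ?thesis
        using t(1) by (auto simp: t(2) monomial_def intro: add.commute)
    qed
    with step keys_add[of "c * x" y] show ?case
      by blast
  qed
  with assms(2) show ?thesis
    by blast
qed

lemma monomial_add: "monomial (s + t) = monomial s * monomial t"
  by (simp add: monomial_def mult_single)

lemma keys_monomial_ideal:
  assumes "monomial_ideal I" "f \<in> I" "a \<in> Poly_Mapping.keys f"
  shows "monomial a \<in> I"
proof -
  obtain T where I: "I = ideal_gen (monomial ` T)"
    using assms(1) by (auto simp: monomial_ideal_def)
  then obtain t b where "t \<in> T" "a = t + b"
    using keys_ideal_gen_monomial assms by metis
  then have "monomial a = monomial b * monomial t" "monomial t \<in> I"
    by (simp_all add: I monomial_add[symmetric] add.commute ideal_gen_base)
  then show ?thesis
    unfolding I by (metis ideal_gen_mult)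
qed

lemma monomial_ideal_add:
  assumes "monomial_ideal I" "monomial a \<in> I"
  shows "monomial (a + b) \<in> I"
proof -
  obtain T where I: "I = ideal_gen (monomial ` T)"
    using assms(1) by (auto simp: monomial_ideal_def)
  show ?thesis
    using assms(2) unfolding I add.commute[of a] monomial_add by (rule ideal_gen_mult)
qed

section \<open>Socle monomials and Tor\<close>

lemma mult_mat_vec_mat_app:
  assumes "A \<in> carrier_mat nr nc" "v \<in> carrier_vec nc" "r < nr"
  shows "(A *\<^sub>v v) $ r = mat_app nc (\<lambda>r c. A $$ (r, c)) (($) v) r"
  using assms by (simp add: mat_app_def scalar_prod_def lessThan_atLeast0)

lemma scalar_prod_mat_app:
  assumes "v \<in> carrier_vec n"
  shows "g \<bullet> v = mat_app n (\<lambda>r c. g $ c) (($) v) r"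
  using assms by (simp add: mat_app_def scalar_prod_def lessThan_atLeast0)

lemma mat_app_vec: "mat_app n A (($) (vec n u)) r = mat_app n A u r"
  by (rule mat_app_cong) simp

text \<open>S itself is placed at level 0 and F_p at level \<open>Suc p\<close>, so that the
  augmentation becomes the first differential. The shift is the one between Tor of S/I and Tor of
  I.\<close>

definition resolution_degrees :: "(nat \<Rightarrow> int list) \<Rightarrow> nat \<Rightarrow> int list" where
  "resolution_degrees D q = (case q of 0 \<Rightarrow> [0] | Suc p \<Rightarrow> D p)"

definition resolution_maps ::
  "('v, 'k::field) mpoly vec \<Rightarrow> (nat \<Rightarrow> ('v, 'k) mpoly mat) \<Rightarrow> nat \<Rightarrow> nat \<Rightarrow> nat \<Rightarrow> ('v, 'k) mpoly"
  where "resolution_maps g A q r c = (case q of 0 \<Rightarrow> g $ c | Suc p \<Rightarrow> A p $$ (r, c))"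

lemma resolution_degrees_simps [simp]:
  "resolution_degrees D 0 = [0]" "resolution_degrees D (Suc p) = D p"
  by (simp_all add: resolution_degrees_def)

lemma resolution_maps_simps:
  "resolution_maps g A 0 = (\<lambda>r c. g $ c)" "resolution_maps g A (Suc p) = (\<lambda>r c. A p $$ (r, c))"
  by (simp_all add: resolution_maps_def fun_eq_iff)

lemma graded_exact_complex_resolution:
  fixes I :: "('v::{finite,linorder}, 'k::field) mpoly set"
  assumes "graded_free_resolution I D g A"
  shows "graded_exact_complex (resolution_degrees D) (resolution_maps g A)"
proof -
  let ?E = "resolution_degrees D" and ?M = "resolution_maps g A"
  let ?app = "\<lambda>q. mat_app (length (?E (Suc q))) (?M q)"
  have hom_g: "\<forall>k<length (D 0). homogeneous (D 0 ! k) (g $ k)"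
    and A: "\<And>i. A i \<in> carrier_mat (length (D i)) (length (D (Suc i)))"
    and hom_A: "\<forall>i. \<forall>r<length (D i). \<forall>c<length (D (Suc i)).
        homogeneous (D (Suc i) ! c - D i ! r) (A i $$ (r, c))"
    and ex0: "{v \<in> carrier_vec (length (D 0)). g \<bullet> v = 0} =
       {A 0 *\<^sub>v w | w. w \<in> carrier_vec (length (D 1))}"
    and ex: "\<And>i. {v \<in> carrier_vec (length (D (Suc i))). A i *\<^sub>v v = 0\<^sub>v (length (D i))} =
       {A (Suc i) *\<^sub>v w | w. w \<in> carrier_vec (length (D (Suc (Suc i))))}"
    using assms unfolding graded_free_resolution_def by auto
  \<comment> \<open>The kernel on F_q of the map one step down, with S below F_0; both exactness
    conditions then read alike.\<close>
  define ker where "ker q = (case q of 0 \<Rightarrow> {v \<in> carrier_vec (length (D 0)). g \<bullet> v = 0}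
    | Suc i \<Rightarrow> {v \<in> carrier_vec (length (D (Suc i))). A i *\<^sub>v v = 0\<^sub>v (length (D i))})" for q
  have ker: "v \<in> ker q \<longleftrightarrow> v \<in> carrier_vec (length (D q)) \<and>
      (\<forall>r<length (?E q). ?app q (($) v) r = 0)" for v q
  proof (cases q)
    case 0
    then show ?thesis
      using scalar_prod_mat_app[of v "length (D 0)" g 0]
      by (auto simp: ker_def resolution_maps_simps)
  next
    case (Suc i)
    have "A i *\<^sub>v v = 0\<^sub>v (length (D i)) \<longleftrightarrow> (\<forall>r<length (D i). (A i *\<^sub>v v) $ r = 0)"
      using A[of i] by (auto simp: vec_eq_iff)
    then show ?thesis
      using mult_mat_vec_mat_app[OF A[of i], of v] Suc
      by (auto simp: ker_def resolution_maps_simps)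
  qed
  have im: "ker q = {A q *\<^sub>v w | w. w \<in> carrier_vec (length (D (Suc q)))}" for q
    using ex0 ex by (cases q) (simp_all add: ker_def One_nat_def)
  show ?thesis
  proof
    fix r q c
    assume "r < length (?E q)" "c < length (?E (Suc q))"
    then show "homogeneous (?E (Suc q) ! c - ?E q ! r) (?M q r c)"
      using hom_g hom_A by (cases q) (auto simp: resolution_maps_simps)
  next
    fix r q and w :: "nat \<Rightarrow> ('v, 'k) mpoly"
    assume r: "r < length (?E q)"
    let ?w = "vec (length (D (Suc q))) w"
    have "A q *\<^sub>v ?w \<in> ker q"
      unfolding im using vec_carrier by blast
    then have "?app q (($) (A q *\<^sub>v ?w)) r = 0"
      using r by (simp add: ker)
    also have "?app q (($) (A q *\<^sub>v ?w)) r = ?app q (?app (Suc q) w) r"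
      by (rule mat_app_cong)
        (simp add: mult_mat_vec_mat_app[OF A] resolution_maps_simps mat_app_vec)
    finally show "?app q (?app (Suc q) w) r = 0" .
  next
    fix q u
    assume "\<And>r. r < length (?E q) \<Longrightarrow> ?app q u r = 0"
    then have "vec (length (D q)) u \<in> ker q"
      by (simp add: ker mat_app_vec)
    then obtain w where w: "w \<in> carrier_vec (length (D (Suc q)))" "vec (length (D q)) u = A q *\<^sub>v w"
      unfolding im by blast
    have "u c = ?app (Suc q) (($) w) c" if "c < length (D q)" for c
    proof -
      have "u c = (A q *\<^sub>v w) $ c"
        using that w by (metis index_vec)
      then show ?thesis
        using that w by (simp add: mult_mat_vec_mat_app[OF A] resolution_maps_simps)
    qed
    then show "\<exists>w. \<forall>c<length (?E (Suc q)). u c = ?app (Suc q) w c"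
      by auto
  qed
qed

text \<open>The nonzero class is that of \<open>w e\<^sub>V\<close> in the Koszul homology of \<open>S/I\<close>.\<close>

lemma tor_nonzero_socle:
  fixes I :: "('v::{finite,linorder}, 'k::field) mpoly set"
  assumes I: "monomial_ideal I" and w: "monomial w \<notin> I"
    and V: "card V = Suc p"
    and supp: "\<And>i. i \<notin> V \<Longrightarrow> Poly_Mapping.lookup w i = 0"
    and socle: "\<And>i. i \<in> V \<Longrightarrow> Var i * monomial w \<in> I"
  shows "tor_nonzero I p (int (mdeg w) + int (Suc p))"
  unfolding tor_nonzero_def
proof (intro allI impI notI)
  fix D g A
  let ?N = "int (mdeg w) + int (Suc p)"
  assume res: "graded_free_resolution I D g A" and eq: "tor_cycles D A p ?N = tor_boundaries D A p ?N"
  interpret graded_exact_complex "resolution_degrees D" "resolution_maps g A"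
    by (rule graded_exact_complex_resolution[OF res])
  have A: "A i \<in> carrier_mat (length (D i)) (length (D (Suc i)))" for i
    using res by (simp add: graded_free_resolution_def)
  have residue: "(residue_mat (A i) *\<^sub>v x) $ r =
      Poly_Mapping.lookup (app (Suc i) v r) 0"
    if "r < length (D i)" "x \<in> carrier_vec (length (D (Suc i)))"
      "\<And>c. c < length (D (Suc i)) \<Longrightarrow> Poly_Mapping.lookup (v c) 0 = x $ c" for i x v r
  proof -
    have "residue_mat (A i) \<in> carrier_mat (length (D i)) (length (D (Suc i)))"
      using A by (simp add: residue_mat_def)
    with that show ?thesis
      using A[of i] by (subst mult_mat_vec_mat_app)
        (auto simp: mat_app_def resolution_maps_simps lookup_sum lookup_mult_0 residue_mat_def)
  qed
  have I_app: "f \<in> I \<longleftrightarrow> (\<exists>u. f = app 0 u 0)" for f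
  proof -
    have I_eq: "I = {g \<bullet> v | v. v \<in> carrier_vec (length (D 0))}"
      using res by (simp add: graded_free_resolution_def)
    have app: "g \<bullet> v = app 0 (($) v) 0" if "v \<in> carrier_vec (length (D 0))" for v
      using scalar_prod_mat_app[OF that, of g 0] by (simp add: resolution_maps_simps)
    show ?thesis
    proof
      assume "f \<in> I"
      then obtain v where "v \<in> carrier_vec (length (D 0))" "f = g \<bullet> v"
        unfolding I_eq by blast
      with app show "\<exists>u. f = app 0 u 0"
        by blast
    next
      assume "\<exists>u. f = app 0 u 0"
      then obtain u where u: "f = app 0 u 0"
        by blast
      have v: "vec (length (D 0)) u \<in> carrier_vec (length (D 0))"
        by (rule vec_carrier)
      have "f = g \<bullet> vec (length (D 0)) u"
        by (simp add: u app[OF v] mat_app_vec)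
      with v show "f \<in> I"
        unfolding I_eq by blast
    qed
  qed
  \<comment> \<open>Level \<open>card V = Suc p\<close> is F_p, and the assumed equality of cycles
    and boundaries supplies \<open>bound\<close>.\<close>
  obtain d u where du: "monomial w = koszul d V + app 0 u 0"
  proof (rule koszul_class_bounds[of ?N V "monomial w"])
    show "homogeneous (?N - int (card V)) (monomial w :: ('v, 'k) mpoly)"
      using homogeneous_monomial[of w] V by simp
    show "\<exists>u. Var i * monomial w = app 0 u 0" if "i \<in> V" for i
      using socle[OF that] I_app by blast
  next
    fix v
    assume hom_v: "\<And>c. c < length (resolution_degrees D (card V)) \<Longrightarrow>
        homogeneous (?N - resolution_degrees D (card V) ! c) (v c)"
      and cycle: "\<And>q r. card V = Suc q \<Longrightarrow> r < length (resolution_degrees D q) \<Longrightarrow>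
        Poly_Mapping.lookup (app q v r) 0 = 0"
    let ?x = "vec (length (D p)) (\<lambda>c. Poly_Mapping.lookup (v c) 0)"
    \<comment> \<open>A nonzero constant coefficient has degree 0, which forces the basis element
      into degree \<open>?N\<close>.\<close>
    have "D p ! c = ?N" if "c < length (D p)" "Poly_Mapping.lookup (v c) 0 \<noteq> 0" for c
      using hom_v[of c] that V by (force simp: homogeneous_def in_keys_iff)
    then have x: "?x \<in> graded_piece (D p) ?N"
      by (auto simp: graded_piece_def)
    have "?x \<in> tor_cycles D A p ?N"
    proof (cases p)
      case 0
      with x show ?thesis by simp
    next
      case (Suc i)
      have "residue_mat (A i) *\<^sub>v ?x = 0\<^sub>v (length (D i))"
      proof (rule eq_vecI)
        fix r assume "r < dim_vec (0\<^sub>v (length (D i)) :: 'k vec)"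
        then show "(residue_mat (A i) *\<^sub>v ?x) $ r = 0\<^sub>v (length (D i)) $ r"
          using residue[of r i ?x v] cycle[of p r] V Suc by simp
      qed (use A[of i] in \<open>simp add: residue_mat_def\<close>)
      with x Suc show ?thesis by simp
    qed
    then obtain b where b: "b \<in> graded_piece (D (Suc p)) ?N" "?x = residue_mat (A p) *\<^sub>v b"
      unfolding eq tor_boundaries_def by blast
    have "Poly_Mapping.lookup (v c) 0 =
        Poly_Mapping.lookup (app (Suc p) (\<lambda>c. Poly_Mapping.single 0 (b $ c)) c) 0"
      if c: "c < length (D p)" for c
    proof -
      have "Poly_Mapping.lookup (v c) 0 = ?x $ c"
        using c by simp
      also have "\<dots> = Poly_Mapping.lookup (app (Suc p) (\<lambda>c. Poly_Mapping.single 0 (b $ c)) c) 0"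
        unfolding b(2) by (rule residue) (use b(1) c in \<open>auto simp: graded_piece_def\<close>)
      finally show ?thesis .
    qed
    then show "\<exists>b. \<forall>c<length (resolution_degrees D (card V)). Poly_Mapping.lookup (v c) 0 =
        Poly_Mapping.lookup (app (card V) b c) 0"
      using V by auto
  qed simp_all
  \<comment> \<open>Compare the coefficients of \<open>w\<close>: an element of \<open>I\<close> has
    none, and neither has \<open>koszul d V\<close>, whose terms involve a variable outside
    \<open>V\<close>.\<close>
  have "app 0 u 0 \<in> I"
    using I_app by blast
  then have "Poly_Mapping.lookup (app 0 u 0) w = 0"
    using keys_monomial_ideal[OF I] w by (metis in_keys_iff)
  moreover have "Poly_Mapping.lookup (koszul d V) w = 0"
    using supp by (rule lookup_koszul_eq_0)
  moreover have "Poly_Mapping.lookup (monomial w :: ('v, 'k) mpoly) w = 1"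
    by (simp add: monomial_def)
  ultimately show False
    unfolding du by (simp add: lookup_add)
qed

section \<open>Ideals of Borel type\<close>

lemma monomial_in_ideal_power:
  fixes I :: "('v::{finite,linorder}, 'k::field) mpoly set"
  assumes "\<And>i. i \<in> W \<Longrightarrow> Var i \<in> J" "Poly_Mapping.keys t \<subseteq> W" "mdeg t = k"
  shows "monomial t \<in> ideal_power J k"
  using assms(2,3)
proof (induction k arbitrary: t)
  case 0
  show ?case by simp
next
  case (Suc k)
  then obtain i where i: "Poly_Mapping.lookup t i \<noteq> 0"
    by (metis mdeg_def sum.neutral nat.distinct(1))
  let ?s = "t - unit_exp i"
  have t: "t = unit_exp i + ?s"
    using exp_eq_unit_add[OF i] by simp
  have "Poly_Mapping.keys ?s \<subseteq> W"
    using Suc.prems(1) by (force simp: in_keys_iff lookup_minus)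
  moreover have "mdeg ?s = k"
    using Suc.prems(2) mdeg_add[of "unit_exp i" ?s] t by simp
  ultimately have "monomial ?s \<in> ideal_power J k"
    by (rule Suc.IH)
  moreover have "Var i \<in> J"
    using i Suc.prems(1) by (intro assms(1)) (auto simp: in_keys_iff)
  moreover have "monomial t = Var i * monomial ?s"
    by (subst t) (simp add: monomial_add Var_def)
  ultimately show ?case
    by (auto simp: ideal_times_def intro!: ideal_gen_base)
qed

lemma colon_Var_saturation:
  fixes I :: "('v::{finite,linorder}, 'k::field) mpoly set"
  assumes I: "monomial_ideal I" and v: "Var j * f \<in> I"
  shows "f \<in> saturation I (ideal_gen {Var j})"
proof -
  obtain T where T: "I = ideal_gen (monomial ` T)"
    using I by (auto simp: monomial_ideal_def)
  interpret Modules.module "(*) :: ('v, 'k) mpoly \<Rightarrow> _ \<Rightarrow> _"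
    by (rule module_mult)
  \<comment> \<open>Exponent 1 suffices. That power unfolds to the product of the ideal with the
    whole ring, which lies in the ideal.\<close>
  have "f * h \<in> I" if "h \<in> ideal_power (ideal_gen {Var j}) 1" for h
  proof -
    have "h \<in> span {a * b | a b. a \<in> span {Var j} \<and> b \<in> UNIV}"
      using that by (simp add: One_nat_def ideal_times_def)
    then have "h \<in> span {Var j}"
    proof (rule ideal_gen_subset[rotated])
      fix b assume "b \<in> {a * b | a b. a \<in> span {Var j :: ('v, 'k) mpoly} \<and> b \<in> UNIV}"
      then show "b \<in> span {Var j}"
        using ideal_gen_mult by (auto simp: mult.commute)
    qed
    then obtain c where "h = c * Var j"
      unfolding span_singleton by blast
    then have "f * h = c * (Var j * f)"
      by (simp only: mult.left_commute mult.commute[of f])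
    then show ?thesis
      using ideal_gen_mult[of "Var j * f" "monomial ` T" c] v by (simp only: T)
  qed
  then have "f \<in> colon I (ideal_power (ideal_gen {Var j}) 1)"
    unfolding colon_def by blast
  then show ?thesis
    unfolding saturation_def by (intro UN_I[of 1]) simp_all
qed

text \<open>Multiplying a generator neither lowers its degree nor leaves \<open>I\<close>, so no
  monomials of smaller degree arise.\<close>

lemma monomial_in_ideal_ge_iff:
  fixes I :: "('v::{finite,linorder}, 'k::field) mpoly set"
  assumes I: "monomial_ideal I"
  shows "monomial t \<in> ideal_ge I e \<longleftrightarrow> monomial t \<in> I \<and> e \<le> int (mdeg t)"
proof
  let ?T = "{t. (monomial t :: ('v, 'k) mpoly) \<in> I \<and> e \<le> int (mdeg t)}"
  have ge: "ideal_ge I e = ideal_gen (monomial ` ?T)"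
    unfolding ideal_ge_def by (rule arg_cong[of _ _ ideal_gen]) blast
  assume "monomial t \<in> ideal_ge I e"
  then obtain s b where "s \<in> ?T" "t = s + b"
    using keys_ideal_gen_monomial[of "monomial t" ?T t] by (auto simp: ge monomial_def)
  then show "monomial t \<in> I \<and> e \<le> int (mdeg t)"
    using monomial_ideal_add[OF I] by (auto simp: mdeg_add)
qed (auto simp: ideal_ge_def intro: ideal_gen_base)

text \<open>In degree 0 the multiple of \<open>v\<close> is outside \<open>I\<close>, in degree
  \<open>k\<close> all are inside. At a degree where this switches, a multiple outside
  \<open>I\<close> is carried into \<open>I\<close> by every variable of \<open>W\<close>.\<close>

lemma exists_socle_multiple:
  fixes I :: "('v::{finite,linorder}, 'k::field) mpoly set"
  assumes v: "monomial v \<notin> I"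
    and bound: "\<And>t. Poly_Mapping.keys t \<subseteq> W \<Longrightarrow> mdeg t = k \<Longrightarrow> monomial (v + t) \<in> I"
  obtains t where "Poly_Mapping.keys t \<subseteq> W" "monomial (v + t) \<notin> I"
    "\<And>i. i \<in> W \<Longrightarrow> monomial (unit_exp i + (v + t)) \<in> I"
proof -
  define P where "P n \<longleftrightarrow> (\<forall>t. Poly_Mapping.keys t \<subseteq> W \<longrightarrow> mdeg t = n \<longrightarrow> (monomial (v + t) :: ('v, 'k) mpoly) \<in> I)" for n
  have "P k"
    using bound by (auto simp: P_def)
  moreover have "\<not> P 0"
    using v by (auto simp: P_def intro!: exI[of _ 0])
  ultimately obtain n where n: "\<not> P n" "P (Suc n)"
    using ex_least_nat_less[of P k] by blast
  then obtain t where t: "Poly_Mapping.keys t \<subseteq> W" "mdeg t = n" "monomial (v + t) \<notin> I"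
    unfolding P_def by blast
  show thesis
  proof (rule that[OF t(1,3)])
    fix i assume "i \<in> W"
    then have "Poly_Mapping.keys (unit_exp i + t) \<subseteq> W"
      using t keys_add[of "unit_exp i" t] by auto
    moreover have "mdeg (unit_exp i + t) = Suc n"
      by (simp add: mdeg_add t)
    ultimately have "monomial (v + (unit_exp i + t)) \<in> I"
      using n unfolding P_def by blast
    then show "monomial (unit_exp i + (v + t)) \<in> I"
      by (simp add: add_ac)
  qed
qed

lemma borel_type_colon_degree:
  fixes I :: "('v::{finite,linorder}, 'k::field) mpoly set"
  assumes borel: "borel_type I" and reg: "ereal (real_of_int e) \<ge> reg I"
    and v: "monomial v \<notin> I" "monomial (unit_exp m + v) \<in> I" "Poly_Mapping.keys v \<subseteq> {..m}"
  shows "int (mdeg v) < e"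
proof -
  have I: "monomial_ideal I"
    using borel by (simp add: borel_type_def)
  have "monomial v \<in> saturation I (ideal_gen {Var m})"
    using colon_Var_saturation[OF I, of m "monomial v"] v(2) by (simp add: Var_def monomial_add)
  then have "monomial v \<in> saturation I (ideal_gen (Var ` {..m}))"
    using borel by (simp add: borel_type_def atMost_def)
  then obtain k where k: "\<And>h. h \<in> ideal_power (ideal_gen (Var ` {..m})) k \<Longrightarrow> monomial v * h \<in> I"
    by (auto simp: saturation_def colon_def)
  have "monomial (v + t) \<in> I" if "Poly_Mapping.keys t \<subseteq> {..m}" "mdeg t = k" for t
    unfolding monomial_add by (intro k monomial_in_ideal_power[OF _ that]) (simp add: ideal_gen_base)
  then obtain t where t: "Poly_Mapping.keys t \<subseteq> {..m}" "monomial (v + t) \<notin> I"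
    "\<And>i. i \<in> {..m} \<Longrightarrow> monomial (unit_exp i + (v + t)) \<in> I"
    using exists_socle_multiple[OF v(1), of "{..m}" k] by metis
  have "card {..m} \<noteq> 0"
    by auto
  then obtain p where p: "card {..m} = Suc p"
    using not0_implies_Suc by blast
  have "Poly_Mapping.lookup (v + t) i = 0" if "i \<notin> {..m}" for i
    using t(1) v(3) that by (auto simp: lookup_add in_keys_iff)
  then have "tor_nonzero I p (int (mdeg (v + t)) + int (Suc p))"
    using t by (intro tor_nonzero_socle[OF I t(2) p]) (auto simp: Var_def monomial_add)
  \<comment> \<open>There are \<open>Suc p\<close> variables but the homological degree is
    \<open>p\<close>; the surplus of 1 makes the bound on the degree of \<open>v\<close>
    strict.\<close>
  then have "ereal (real_of_int (int (mdeg (v + t)) + int (Suc p) - int p)) \<le> reg I"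
    unfolding reg_def by (intro Sup_upper) blast
  from order_trans[OF this reg] show ?thesis
    by (simp add: mdeg_add)
qed

theorem theorem1p5:
  fixes I :: "('v::{finite,linorder}, 'k::field) mpoly set" and e :: int
  assumes "infinite (UNIV :: 'k set)"
    and "CARD('v) \<ge> 2"
    and "borel_type I"
    and "ereal (real_of_int e) \<ge> reg I"
  shows "stable_ideal (ideal_ge I e)"
proof -
  have I: "monomial_ideal I"
    using assms(3) by (simp add: borel_type_def)
  have "ideal_ge I e = ideal_gen (monomial ` {t. monomial t \<in> I \<and> e \<le> int (mdeg t)})"
    unfolding ideal_ge_def by (rule arg_cong[of _ _ ideal_gen]) blast
  then have mon: "monomial_ideal (ideal_ge I e)"
    unfolding monomial_ideal_def by blast
  have "monomial (unit_exp i + u - unit_exp (max_var u)) \<in> ideal_ge I e"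
    if u: "monomial u \<in> ideal_ge I e" "u \<noteq> 0" and i: "i < max_var u" for u i
  proof -
    define m where "m = max_var u"
    have "Poly_Mapping.keys u \<noteq> {}"
      using u(2) by (metis empty_iff in_keys_iff lookup_zero poly_mapping_eqI)
    then have m: "m \<in> Poly_Mapping.keys u" "Poly_Mapping.keys u \<subseteq> {..m}"
      unfolding m_def max_var_def by auto
    then have u_eq: "unit_exp m + (u - unit_exp m) = u"
      by (intro exp_eq_unit_add) (simp add: in_keys_iff)
    define v where "v = unit_exp i + (u - unit_exp m)"
    \<comment> \<open>The equation x_m v = x_i u avoids subtraction; membership of x_m v in
      \<open>I\<close>, the degree of \<open>v\<close> and its support all follow from it.\<close>
    have u_v: "unit_exp m + v = unit_exp i + u"
      unfolding v_def by (subst u_eq[symmetric]) (simp add: add_ac)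
    then have v: "unit_exp i + u - unit_exp m = v"
      by (metis add_diff_cancel_left')
    have uI: "monomial u \<in> I" "e \<le> int (mdeg u)"
      using u(1) by (simp_all add: monomial_in_ideal_ge_iff[OF I])
    have "mdeg v = mdeg u"
      using u_v by (metis add_left_cancel mdeg_add mdeg_unit_exp)
    then have deg: "e \<le> int (mdeg v)"
      using uI by simp
    have "monomial v \<in> I"
    proof (rule ccontr)
      assume "monomial v \<notin> I"
      moreover have "monomial (unit_exp m + v) \<in> I"
        unfolding u_v add.commute[of _ u] using I uI(1) by (rule monomial_ideal_add)
      moreover have "Poly_Mapping.keys v \<subseteq> {..m}"
      proof -
        have "Poly_Mapping.keys v \<subseteq> Poly_Mapping.keys (unit_exp m + v)"
          by (auto simp: in_keys_iff lookup_add)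
        also have "\<dots> \<subseteq> {..m}"
          unfolding u_v using keys_add[of "unit_exp i" u] m(2) i by (auto simp: m_def)
        finally show ?thesis .
      qed
      ultimately have "int (mdeg v) < e"
        by (rule borel_type_colon_degree[OF assms(3,4)])
      with deg show False by simp
    qed
    with deg show ?thesis
      by (simp add: monomial_in_ideal_ge_iff[OF I] v flip: m_def)
  qed
  with mon show ?thesis
    unfolding stable_ideal_def by blast
qed

end
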